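(* Let $(\mathfrak A[\|\cdot\|_{\mathfrak A}],\mathfrak A_0)$ and $(\mathfrak B[\|\cdot\|_{\mathfrak B}],\mathfrak B_0)$ be (unital) Banach quasi *-algebras, let $\bar n$ be a uniform cross-norm on $\mathfrak A\otimes\mathfrak B$, and let $\pi:\mathfrak A\widehat\otimes_{\bar n}\mathfrak B\to\mathcal L^\dagger(\mathcal D_\pi,\mathcal H_\pi)[\tau_w]$ be a continuous *-representation of the tensor product Banach quasi *-algebra $(\mathfrak A\widehat\otimes_{\bar n}\mathfrak B,\mathfrak A_0\otimes\mathfrak B_0)$. Then there exist unique continuous *-representations $\pi_1:\mathfrak A[\|\cdot\|_{\mathfrak A}]\to\mathcal L^\dagger(\mathcal D_\pi,\mathcal H_\pi)[\tau_w]$ and $\pi_2:\mathfrak B[\|\cdot\|_{\mathfrak B}]\to\mathcal L^\dagger(\mathcal D_\pi,\mathcal H_\pi)[\tau_w]$ such that for all $x\in\mathfrak A_0$, $y\in\mathfrak B_0$, $a\in\mathfrak A$, $b\in\mathfrak B$, $$\pi(x\otimes b)=\pi_1(x)\,\square\,\pi_2(b)=\pi_2(b)\,\square\,\pi_1(x),\qquad \pi(a\otimes y)=\pi_1(a)\,\square\,\pi_2(y)=\pi_2(y)\,\square\,\pi_1(a).$$ Moreover $\pi_1,\pi_2$ are the restrictions of $\pi$ to $\mathfrak A$ and $\mathfrak B$, respectively, i.e. $\pi_1(a)=\pi(a\otimes e_{\mathfrak B})$ and $\pi_2(b)=\pi(e_{\mathfrak A}\otimes b)$.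
   Context: All vector spaces are complex. A quasi *-algebra $(\mathfrak A,\mathfrak A_0)$ is a vector space $\mathfrak A$ with a *-algebra $\mathfrak A_0\subseteq\mathfrak A$ (as a subspace) such that: (i) products $ax$, $xa$ ($a\in\mathfrak A$, $x\in\mathfrak A_0$) are defined in $\mathfrak A$ and bilinear, extending the multiplication of $\mathfrak A_0$; (ii) $(xa)y=x(ay)$, $a(xy)=(ax)y$ for $x,y\in\mathfrak A_0$, $a\in\mathfrak A$; (iii) $\mathfrak A$ has an involution extending that of $\mathfrak A_0$ with $(ax)^*=x^*a^*$, $(xa)^*=a^*x^*$. It is unital if there is $e\in\mathfrak A_0$ with $ae=a=ea$ for all $a\in\mathfrak A$. It is a normed (Banach) quasi *-algebra if $\mathfrak A$ carries a (complete) norm with $\|a^*\|=\|a\|$, $\mathfrak A_0$ dense in $\mathfrak A$, and $a\mapsto ax$ continuous for every $x\in\mathfrak A_0$. Standing convention: quasi *-algebras are unital, with units $e_{\mathfrak A},e_{\mathfrak B}$ of norm $1$. $\mathfrak A\otimes\mathfrak B$ is a quasi *-algebra over $\mathfrak A_0\otimes\mathfrak B_0$ via $(a\otimes b)(x\otimes y)=ax\otimes by$, $(x\otimes y)(a\otimes b)=xa\otimes yb$, $(a\otimes b)^*=a^*\otimes b^*$. A cross-norm $\bar n$ on $\mathfrak A\otimes\mathfrak B$ is a norm with $\|a\otimes b\|_{\bar n}=\|a\|_{\mathfrak A}\|b\|_{\mathfrak B}$; it is uniform if for all bounded linear $T_1:\mathfrak A\to\mathfrak A$, $T_2:\mathfrak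 B\to\mathfrak B$ the operator $T_1\otimes T_2$ is $\bar n$-bounded and its extension to the completion has norm $\le\|T_1\|\|T_2\|$. $\mathfrak A\otimes_{\bar n}\mathfrak B$ is the normed space and $\mathfrak A\widehat\otimes_{\bar n}\mathfrak B$ its completion. It is understood that the involution is $\bar n$-isometric, so that $(\mathfrak A\otimes_{\bar n}\mathfrak B,\mathfrak A_0\otimes\mathfrak B_0)$ is a normed quasi *-algebra and $(\mathfrak A\widehat\otimes_{\bar n}\mathfrak B,\mathfrak A_0\otimes\mathfrak B_0)$ (operations extended by continuity) is a Banach quasi *-algebra. For a dense subspace $\mathcal D$ of a Hilbert space $\mathcal H$, $\mathcal L^\dagger(\mathcal D,\mathcal H)$ is the vector space of closable linear operators $T:\mathcal D\to\mathcal H$ whose adjoint has domain $\mathcal D(T^* )\supseteq\mathcal D$; $T^\dagger:=T^*|_{\mathcal D}$; the partial product $T\,\square\,S:=(T^\dagger)^*S$ is defined whenever $S\mathcal D\subseteq\mathcal D((T^\dagger)^* )$ and $T^\dagger\mathcal D\subseteq\mathcal D(S^* )$. The weak topology $\tau_w$ is given by the seminorms $T\mapsto|\langle T\xi|\eta\rangle|$, $\xi,\eta\in\mathcal D$. A *-representation of $(\mathfrak A,\mathfrak A_0)$ is a linear map $\pi:\mathfrak A\to\mathcal L^\dagger(\mathcal D_\pi,\mathcal H_\pi)$, $\mathcal D_\pi$ dense in the Hilbert space $\mathcal H_\pi$, such that $\pi(a^* )=\pi(a)^\dagger$ for all $a\in\mathfrak A$; for $a\in\mathfrak A$, $x\in\mathfrak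 A_0$ the product $\pi(a)\,\square\,\pi(x)$ is defined and equals $\pi(ax)$; and $\pi(e)$ is the identity on $\mathcal D_\pi$. *)

theory Defs
  imports "HOL-Analysis.Analysis"
begin

section \<open>Complex vector spaces, normed spaces and Hilbert spaces\<close>

class complex_vector = real_vector +
  fixes scaleC :: "complex \<Rightarrow> 'a \<Rightarrow> 'a" (infixr "*\<^sub>C" 75)
  assumes scaleC_add_right: "c *\<^sub>C (x + y) = c *\<^sub>C x + c *\<^sub>C y"
    and scaleC_add_left: "(c + d) *\<^sub>C x = c *\<^sub>C x + d *\<^sub>C x"
    and scaleC_scaleC: "c *\<^sub>C (d *\<^sub>C x) = (c * d) *\<^sub>C x"
    and scaleC_one: "1 *\<^sub>C x = x"
    and scaleR_scaleC: "r *\<^sub>R x = complex_of_real r *\<^sub>C x"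

global_interpretation complex_vector: vector_space "scaleC :: complex \<Rightarrow> 'a \<Rightarrow> 'a::complex_vector"
  defines csubspace = complex_vector.subspace
    and cspan = complex_vector.span
  by unfold_locales (simp_all add: scaleC_add_right scaleC_add_left scaleC_scaleC scaleC_one)

abbreviation clinear :: "('a::complex_vector \<Rightarrow> 'b::complex_vector) \<Rightarrow> bool"
  where "clinear \<equiv> Vector_Spaces.linear scaleC scaleC"

class complex_normed_vector = complex_vector + real_normed_vector +
  assumes norm_scaleC: "norm (c *\<^sub>C x) = cmod c * norm x"

definition bounded_clinear ::
    "('a::complex_normed_vector \<Rightarrow> 'b::complex_normed_vector) \<Rightarrow> bool"
  where "bounded_clinear f \<longleftrightarrow> clinear f \<and> bounded_linear f"

text \<open>The inner product is linear in its first argument. A Hilbert space is a type of sort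
  \<open>{complex_inner, complete_space}\<close>.\<close>

class complex_inner = complex_normed_vector +
  fixes cinner :: "'a \<Rightarrow> 'a \<Rightarrow> complex"
  assumes cinner_commute: "cinner x y = cnj (cinner y x)"
    and cinner_add_left: "cinner (x + y) z = cinner x z + cinner y z"
    and cinner_scaleC_left: "cinner (c *\<^sub>C x) y = c * cinner x y"
    and cinner_ge_zero: "0 \<le> Re (cinner x x)"
    and cinner_eq_zero_iff: "cinner x x = 0 \<longleftrightarrow> x = 0"
    and norm_eq_sqrt_cinner: "norm x = sqrt (Re (cinner x x))"


section \<open>Quasi *-algebras\<close>

text \<open>The field \<open>qmult\<close> renders both partial products \<open>ax\<close> and \<open>xa\<close>; its value is meaningful
  only when at least one factor lies in the *-algebra \<open>core\<close>. That the two products extend the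
  multiplication of the *-algebra is thereby built in, and the axioms of a *-algebra for
  \<open>core\<close> are instances of the axioms below.\<close>

record 'a qsa =
  core :: "'a set"
  qmult :: "'a \<Rightarrow> 'a \<Rightarrow> 'a"
  qstar :: "'a \<Rightarrow> 'a"
  qunit :: 'a

locale quasi_star_algebra =
  fixes Q :: "'a::complex_vector qsa"
  assumes core_subspace: "csubspace (core Q)"
    and core_mult: "x \<in> core Q \<Longrightarrow> y \<in> core Q \<Longrightarrow> qmult Q x y \<in> core Q"
    and core_star: "x \<in> core Q \<Longrightarrow> qstar Q x \<in> core Q"
    and mult_add_left: "a \<in> core Q \<and> b \<in> core Q \<or> c \<in> core Q \<Longrightarrow>
          qmult Q (a + b) c = qmult Q a c + qmult Q b c"
    and mult_add_right: "a \<in> core Q \<or> b \<in> core Q \<and> c \<in> core Q \<Longrightarrow>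
          qmult Q a (b + c) = qmult Q a b + qmult Q a c"
    and mult_scaleC_left: "a \<in> core Q \<or> b \<in> core Q \<Longrightarrow>
          qmult Q (z *\<^sub>C a) b = z *\<^sub>C qmult Q a b"
    and mult_scaleC_right: "a \<in> core Q \<or> b \<in> core Q \<Longrightarrow>
          qmult Q a (z *\<^sub>C b) = z *\<^sub>C qmult Q a b"
    and mult_assoc_middle: "x \<in> core Q \<Longrightarrow> y \<in> core Q \<Longrightarrow>
          qmult Q (qmult Q x a) y = qmult Q x (qmult Q a y)"
    and mult_assoc_right: "x \<in> core Q \<Longrightarrow> y \<in> core Q \<Longrightarrow>
          qmult Q a (qmult Q x y) = qmult Q (qmult Q a x) y"
    and star_add: "qstar Q (a + b) = qstar Q a + qstar Q b"
    and star_scaleC: "qstar Q (z *\<^sub>C a) = cnj z *\<^sub>C qstar Q a"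
    and star_star: "qstar Q (qstar Q a) = a"
    and star_mult: "a \<in> core Q \<or> b \<in> core Q \<Longrightarrow>
          qstar Q (qmult Q a b) = qmult Q (qstar Q b) (qstar Q a)"
    and unit_core: "qunit Q \<in> core Q"
    and mult_unit_right: "qmult Q a (qunit Q) = a"
    and mult_unit_left: "qmult Q (qunit Q) a = a"

locale normed_quasi_star_algebra = quasi_star_algebra Q
  for Q :: "'a::complex_normed_vector qsa" +
  assumes norm_star: "norm (qstar Q a) = norm a"
    and core_dense: "closure (core Q) = UNIV"
    and continuous_mult_right: "x \<in> core Q \<Longrightarrow> continuous_on UNIV (\<lambda>a. qmult Q a x)"
    and norm_unit: "norm (qunit Q) = 1"

locale banach_quasi_star_algebra = normed_quasi_star_algebra Q
  for Q :: "'a::{complex_normed_vector, complete_space} qsa"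


section \<open>The algebraic tensor product\<close>

text \<open>Elements are formal finite sums of pairs, given as lists, modulo the congruence generated
  by commutativity and the bilinearity relations.\<close>

inductive tensor_eq :: "('a::complex_vector \<times> 'b::complex_vector) list \<Rightarrow> ('a \<times> 'b) list \<Rightarrow> bool"
  where
    refl: "tensor_eq ps ps"
  | sym: "tensor_eq ps qs \<Longrightarrow> tensor_eq qs ps"
  | trans: "tensor_eq ps qs \<Longrightarrow> tensor_eq qs rs \<Longrightarrow> tensor_eq ps rs"
  | append: "tensor_eq ps ps' \<Longrightarrow> tensor_eq qs qs' \<Longrightarrow> tensor_eq (ps @ qs) (ps' @ qs')"
  | commute: "tensor_eq (ps @ qs) (qs @ ps)"
  | zero: "tensor_eq [(0, b)] []"
  | add_left: "tensor_eq [(a + a', b)] [(a, b), (a', b)]"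
  | add_right: "tensor_eq [(a, b + b')] [(a, b), (a, b')]"
  | balanced: "tensor_eq [(c *\<^sub>C a, b)] [(a, c *\<^sub>C b)]"

quotient_type (overloaded) ('a, 'b) tensor =
    "('a::complex_vector \<times> 'b::complex_vector) list" / tensor_eq
  morphisms rep_tensor abs_tensor
  by (rule equivpI)
     (auto intro!: reflpI sympI transpI intro: tensor_eq.refl tensor_eq.sym tensor_eq.trans)

lemma tensor_eq_map_scaleC:
  "tensor_eq ps qs \<Longrightarrow>
    tensor_eq (map (\<lambda>(a, b). (c *\<^sub>C a, b)) ps) (map (\<lambda>(a, b). (c *\<^sub>C a, b)) qs)"
proof (induction rule: tensor_eq.induct)
  case (balanced d a b)
  have "tensor_eq [(d *\<^sub>C (c *\<^sub>C a), b)] [(c *\<^sub>C a, d *\<^sub>C b)]" by (rule tensor_eq.balanced)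
  then show ?case by (simp add: scaleC_scaleC mult.commute)
qed (auto intro: tensor_eq.intros simp: scaleC_add_right)

lemma tensor_eq_neg_cancel: "tensor_eq (map (\<lambda>(a, b). ((-1) *\<^sub>C a, b)) ps @ ps) []"
proof (induction ps)
  case Nil
  show ?case by (simp add: tensor_eq.refl)
next
  case (Cons p ps)
  obtain a b where p: "p = (a, b)" by force
  let ?m = "map (\<lambda>(a, b). ((-1) *\<^sub>C a, b))"
  have a: "(-1) *\<^sub>C a + a = 0"
    using scaleC_add_left[of "-1" 1 a] by (simp add: scaleC_one)
  have "tensor_eq [((-1) *\<^sub>C a + a, b)] [((-1) *\<^sub>C a, b), (a, b)]" by (rule tensor_eq.add_left)
  then have 1: "tensor_eq [((-1) *\<^sub>C a, b), (a, b)] []"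
    unfolding a by (meson tensor_eq.sym tensor_eq.trans tensor_eq.zero)
  have "tensor_eq (([((-1) *\<^sub>C a, b)] @ (?m ps @ [(a, b)])) @ ps)
                  (([((-1) *\<^sub>C a, b)] @ ([(a, b)] @ ?m ps)) @ ps)"
    by (intro tensor_eq.append tensor_eq.refl tensor_eq.commute)
  then have 2: "tensor_eq (?m (p # ps) @ p # ps)
                  ([((-1) *\<^sub>C a, b), (a, b)] @ (?m ps @ ps))"
    by (simp only: p list.map prod.case append_Cons append_Nil append_assoc)
  have "tensor_eq ([((-1) *\<^sub>C a, b), (a, b)] @ (?m ps @ ps)) ([] @ [])"
    by (intro tensor_eq.append 1 Cons.IH)
  from tensor_eq.trans[OF 2 this] show ?case by (simp only: append_Nil)
qed

instantiation tensor :: (complex_vector, complex_vector) complex_vector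
begin

lift_definition zero_tensor :: "('a, 'b) tensor" is "[]" .

lift_definition plus_tensor :: "('a, 'b) tensor \<Rightarrow> ('a, 'b) tensor \<Rightarrow> ('a, 'b) tensor"
  is "(@)" by (rule tensor_eq.append)

lift_definition scaleC_tensor :: "complex \<Rightarrow> ('a, 'b) tensor \<Rightarrow> ('a, 'b) tensor"
  is "\<lambda>c. map (\<lambda>(a, b). (c *\<^sub>C a, b))" by (rule tensor_eq_map_scaleC)

definition uminus_tensor :: "('a, 'b) tensor \<Rightarrow> ('a, 'b) tensor"
  where "uminus_tensor t = (-1) *\<^sub>C t"

definition minus_tensor :: "('a, 'b) tensor \<Rightarrow> ('a, 'b) tensor \<Rightarrow> ('a, 'b) tensor"
  where "minus_tensor s t = s + (- t)"

definition scaleR_tensor :: "real \<Rightarrow> ('a, 'b) tensor \<Rightarrow> ('a, 'b) tensor"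
  where "scaleR_tensor r t = complex_of_real r *\<^sub>C t"

lemma tensor_vector_laws:
  fixes s t u :: "('a, 'b) tensor"
  shows "s + t + u = s + (t + u)" "s + t = t + s" "0 + s = s" "- s + s = 0"
    "c *\<^sub>C (s + t) = c *\<^sub>C s + c *\<^sub>C t" "c *\<^sub>C (d *\<^sub>C s) = (c * d) *\<^sub>C s" "1 *\<^sub>C s = s"
  subgoal by transfer (simp add: tensor_eq.refl)
  subgoal by transfer (simp add: tensor_eq.commute)
  subgoal by transfer (simp add: tensor_eq.refl)
  subgoal unfolding uminus_tensor_def by transfer (rule tensor_eq_neg_cancel)
  subgoal by transfer (simp add: tensor_eq.refl)
  subgoal by transfer (simp add: tensor_eq.refl scaleC_scaleC case_prod_unfold comp_def)
  subgoal by transfer (simp add: tensor_eq.refl scaleC_one)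
  done

lemma tensor_scaleC_add_left:
  fixes s :: "('a, 'b) tensor"
  shows "(c + d) *\<^sub>C s = c *\<^sub>C s + d *\<^sub>C s"
proof transfer
  fix c d :: complex and ps :: "('a \<times> 'b) list"
  let ?m = "\<lambda>c. map (\<lambda>(a, b). (c *\<^sub>C a, b)) :: ('a \<times> 'b) list \<Rightarrow> _"
  show "tensor_eq (?m (c + d) ps) (?m c ps @ ?m d ps)"
  proof (induction ps)
    case Nil
    show ?case by (simp add: tensor_eq.refl)
  next
    case (Cons p ps)
    obtain a b where p: "p = (a, b)" by force
    have "tensor_eq [((c + d) *\<^sub>C a, b)] [(c *\<^sub>C a, b), (d *\<^sub>C a, b)]"
      using tensor_eq.add_left[of "c *\<^sub>C a" "d *\<^sub>C a" b] by (simp only: scaleC_add_left)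
    then have "tensor_eq ([((c + d) *\<^sub>C a, b)] @ ?m (c + d) ps)
                    ([(c *\<^sub>C a, b), (d *\<^sub>C a, b)] @ (?m c ps @ ?m d ps))"
      by (intro tensor_eq.append Cons.IH)
    then have 1: "tensor_eq (?m (c + d) (p # ps))
                    (([(c *\<^sub>C a, b)] @ ([(d *\<^sub>C a, b)] @ ?m c ps)) @ ?m d ps)"
      by (simp only: p list.map prod.case append_Cons append_Nil append_assoc)
    have "tensor_eq (([(c *\<^sub>C a, b)] @ ([(d *\<^sub>C a, b)] @ ?m c ps)) @ ?m d ps)
                    (([(c *\<^sub>C a, b)] @ (?m c ps @ [(d *\<^sub>C a, b)])) @ ?m d ps)"
      by (intro tensor_eq.append tensor_eq.refl tensor_eq.commute)
    from tensor_eq.trans[OF 1 this] show ?case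
      by (simp only: p list.map prod.case append_Cons append_Nil append_assoc)
  qed
qed

instance
  by standard
     (simp_all only: minus_tensor_def scaleR_tensor_def of_real_add of_real_mult of_real_1,
      (rule tensor_vector_laws tensor_scaleC_add_left tensor_vector_laws(5,6)[symmetric])+)

end

lift_definition tensor :: "'a::complex_vector \<Rightarrow> 'b::complex_vector \<Rightarrow> ('a, 'b) tensor"
    (infixr "\<otimes>\<^sub>t" 72)
  is "\<lambda>a b. [(a, b)]" .

lemma tensor_bilinear:
  fixes a a' :: "'a::complex_vector" and b b' :: "'b::complex_vector"
  shows tensor_add_left: "(a + a') \<otimes>\<^sub>t b = a \<otimes>\<^sub>t b + a' \<otimes>\<^sub>t b"
    and tensor_add_right: "a \<otimes>\<^sub>t (b + b') = a \<otimes>\<^sub>t b + a \<otimes>\<^sub>t b'"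
    and tensor_scaleC_left: "(c *\<^sub>C a) \<otimes>\<^sub>t b = c *\<^sub>C (a \<otimes>\<^sub>t b)"
    and tensor_scaleC_right: "a \<otimes>\<^sub>t (c *\<^sub>C b) = c *\<^sub>C (a \<otimes>\<^sub>t b)"
  subgoal by transfer (simp add: tensor_eq.add_left)
  subgoal by transfer (simp add: tensor_eq.add_right)
  subgoal by transfer (simp add: tensor_eq.refl)
  subgoal by transfer (simp, metis tensor_eq.balanced tensor_eq.sym)
  done

definition list_extend :: "('a \<Rightarrow> 'b \<Rightarrow> 'c::comm_monoid_add) \<Rightarrow> ('a \<times> 'b) list \<Rightarrow> 'c"
  where "list_extend f ps = (\<Sum>(a, b)\<leftarrow>ps. f a b)"

text \<open>The additive map on the tensor product sending each \<open>a \<otimes>\<^sub>t b\<close> to \<open>f a b\<close>. By the lemmas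
  below, it is independent of the choice of representative when \<open>f\<close> is biadditive and satisfies
  \<open>f (c *\<^sub>C a) b = f a (c *\<^sub>C b)\<close>; this covers linear as well as conjugate-linear extensions.\<close>

definition tensor_extend ::
    "('a::complex_vector \<Rightarrow> 'b::complex_vector \<Rightarrow> 'c::ab_group_add) \<Rightarrow> ('a, 'b) tensor \<Rightarrow> 'c"
  where "tensor_extend f t = list_extend f (rep_tensor t)"

definition balanced_biadditive ::
    "('a::complex_vector \<Rightarrow> 'b::complex_vector \<Rightarrow> 'c::ab_group_add) \<Rightarrow> bool"
  where "balanced_biadditive f \<longleftrightarrow>
    (\<forall>a a' b. f (a + a') b = f a b + f a' b) \<and>
    (\<forall>a b b'. f a (b + b') = f a b + f a b') \<and>
    (\<forall>c a b. f (c *\<^sub>C a) b = f a (c *\<^sub>C b))"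

lemma list_extend_simps [simp]:
  "list_extend f [] = 0"
  "list_extend f ((a, b) # ps) = f a b + list_extend f ps"
  "list_extend f (ps @ qs) = list_extend f ps + list_extend f qs"
  by (simp_all add: list_extend_def)

lemma list_extend_tensor: "list_extend (\<otimes>\<^sub>t) ps = abs_tensor ps"
proof (induction ps)
  case Nil
  show ?case by (simp add: zero_tensor_def)
next
  case (Cons p ps)
  obtain a b where "p = (a, b)" by force
  then show ?case using Cons
    by (simp add: tensor.abs_eq plus_tensor.abs_eq)
qed

lemma list_extend_cong_tensor_eq:
  assumes "tensor_eq ps qs" and f: "balanced_biadditive f"
  shows "list_extend f ps = list_extend f qs"
  using assms(1)
proof (induction rule: tensor_eq.induct)
  case (zero b)
  have "f (0 + 0) b = f 0 b + f 0 b" using f unfolding balanced_biadditive_def by blast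
  then show ?case by simp
qed (use f in \<open>auto simp: balanced_biadditive_def add.commute\<close>)

lemma list_extend_cong:
  assumes "list_extend (\<otimes>\<^sub>t) ps = list_extend (\<otimes>\<^sub>t) qs" and "balanced_biadditive f"
  shows "list_extend f ps = list_extend f qs"
  using assms by (simp add: list_extend_tensor tensor.abs_eq_iff list_extend_cong_tensor_eq)

lemma list_extend_rep_tensor: "list_extend (\<otimes>\<^sub>t) (rep_tensor t) = t"
  by (simp add: list_extend_tensor Quotient3_abs_rep[OF Quotient3_tensor])

lemma tensor_extend_list_extend:
  assumes "balanced_biadditive f"
  shows "tensor_extend f (list_extend (\<otimes>\<^sub>t) ps) = list_extend f ps"
  unfolding tensor_extend_def by (rule list_extend_cong) (simp_all add: assms list_extend_rep_tensor)

lemma tensor_extend_tensor: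
  assumes "balanced_biadditive f"
  shows "tensor_extend f (a \<otimes>\<^sub>t b) = f a b"
  using tensor_extend_list_extend[OF assms, of "[(a, b)]"] by simp

lemma tensor_extend_add:
  assumes "balanced_biadditive f"
  shows "tensor_extend f (s + t) = tensor_extend f s + tensor_extend f t"
  using tensor_extend_list_extend[OF assms, of "rep_tensor s @ rep_tensor t"]
  by (simp add: list_extend_rep_tensor) (simp add: tensor_extend_def)

definition tensor_map ::
    "('a::complex_vector \<Rightarrow> 'c::complex_vector) \<Rightarrow> ('b::complex_vector \<Rightarrow> 'd::complex_vector) \<Rightarrow>
     ('a, 'b) tensor \<Rightarrow> ('c, 'd) tensor"
  where "tensor_map S T = tensor_extend (\<lambda>a b. S a \<otimes>\<^sub>t T b)"

lemma tensor_map_tensor: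
  assumes "clinear S" and "clinear T"
  shows "tensor_map S T (a \<otimes>\<^sub>t b) = S a \<otimes>\<^sub>t T b"
proof -
  interpret S: Vector_Spaces.linear scaleC scaleC S by fact
  interpret T: Vector_Spaces.linear scaleC scaleC T by fact
  show ?thesis unfolding tensor_map_def
    by (rule tensor_extend_tensor)
       (simp add: balanced_biadditive_def tensor_bilinear S.add S.scale T.add T.scale)
qed


section \<open>The tensor product of quasi *-algebras\<close>

definition tensor_core ::
    "'a::complex_vector qsa \<Rightarrow> 'b::complex_vector qsa \<Rightarrow> ('a, 'b) tensor set"
  where "tensor_core A B = cspan {x \<otimes>\<^sub>t y | x y. x \<in> core A \<and> y \<in> core B}"

definition tensor_star ::
    "'a::complex_vector qsa \<Rightarrow> 'b::complex_vector qsa \<Rightarrow> ('a, 'b) tensor \<Rightarrow> ('a, 'b) tensor"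
  where "tensor_star A B = tensor_extend (\<lambda>a b. qstar A a \<otimes>\<^sub>t qstar B b)"

text \<open>\<open>(\<Sum>\<^sub>i a\<^sub>i \<otimes> b\<^sub>i) (\<Sum>\<^sub>j x\<^sub>j \<otimes> y\<^sub>j) = \<Sum>\<^sub>i \<Sum>\<^sub>j a\<^sub>i x\<^sub>j \<otimes> b\<^sub>i y\<^sub>j\<close>, where one of the two factors is
  written with entries in the *-algebras only. The lemma \<open>tensor_mult_eq\<close> shows that the
  result does not depend on the representations chosen.\<close>

definition tensor_mult ::
    "'a::complex_vector qsa \<Rightarrow> 'b::complex_vector qsa \<Rightarrow>
     ('a, 'b) tensor \<Rightarrow> ('a, 'b) tensor \<Rightarrow> ('a, 'b) tensor"
  where "tensor_mult A B s t =
    (THE r. \<exists>ps qs. s = (\<Sum>(a, b)\<leftarrow>ps. a \<otimes>\<^sub>t b) \<and> t = (\<Sum>(x, y)\<leftarrow>qs. x \<otimes>\<^sub>t y) \<and>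
       (set ps \<subseteq> core A \<times> core B \<or> set qs \<subseteq> core A \<times> core B) \<and>
       r = (\<Sum>(a, b)\<leftarrow>ps. \<Sum>(x, y)\<leftarrow>qs. qmult A a x \<otimes>\<^sub>t qmult B b y))"

definition tensor_qsa ::
    "'a::complex_vector qsa \<Rightarrow> 'b::complex_vector qsa \<Rightarrow> ('a, 'b) tensor qsa"
  where "tensor_qsa A B =
    \<lparr>core = tensor_core A B, qmult = tensor_mult A B, qstar = tensor_star A B,
     qunit = qunit A \<otimes>\<^sub>t qunit B\<rparr>"

lemma tensor_star_tensor:
  assumes "quasi_star_algebra A" and "quasi_star_algebra B"
  shows "tensor_star A B (a \<otimes>\<^sub>t b) = qstar A a \<otimes>\<^sub>t qstar B b"
  unfolding tensor_star_def
  by (rule tensor_extend_tensor)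
     (simp add: balanced_biadditive_def tensor_bilinear
        quasi_star_algebra.star_add[OF assms(1)] quasi_star_algebra.star_add[OF assms(2)]
        quasi_star_algebra.star_scaleC[OF assms(1)] quasi_star_algebra.star_scaleC[OF assms(2)])

lemma csubspace_projection:
  fixes S :: "'a::complex_vector set"
  assumes "csubspace S"
  obtains P where "clinear P" "\<And>x. P x \<in> S" "\<And>x. x \<in> S \<Longrightarrow> P x = x"
proof -
  interpret vector_space_pair "scaleC :: complex \<Rightarrow> 'a \<Rightarrow> 'a" "scaleC :: complex \<Rightarrow> 'a \<Rightarrow> 'a"
    by unfold_locales
  have "clinear (\<lambda>x. x :: 'a)" by unfold_locales auto
  from linear_exists_left_inverse_on[OF this assms[unfolded csubspace_def]]
  obtain P where "range P \<subseteq> S" "clinear P" "\<forall>v\<in>S. P v = v" by auto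
  then show ?thesis using that by blast
qed

definition list_mult where
  "list_mult A B ps qs =
     (\<Sum>(a, b)\<leftarrow>ps. \<Sum>(x, y)\<leftarrow>qs. qmult A a x \<otimes>\<^sub>t qmult B b y)"

lemma balanced_biadditive_sum_list:
  assumes "\<And>q. q \<in> set qs \<Longrightarrow> balanced_biadditive (\<lambda>a b. f a b q)"
  shows "balanced_biadditive (\<lambda>a b. \<Sum>q\<leftarrow>qs. f a b q)"
  using assms
  by (induction qs) (simp_all add: balanced_biadditive_def algebra_simps)

lemma sum_list_swap:
  fixes f :: "'a \<Rightarrow> 'b \<Rightarrow> 'c::comm_monoid_add"
  shows "(\<Sum>p\<leftarrow>ps. \<Sum>q\<leftarrow>qs. f p q) = (\<Sum>q\<leftarrow>qs. \<Sum>p\<leftarrow>ps. f p q)"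
  by (induction ps) (simp_all add: sum_list_addf)

context
  fixes A :: "'a::complex_vector qsa" and B :: "'b::complex_vector qsa"
  assumes A: "quasi_star_algebra A" and B: "quasi_star_algebra B"
begin

interpretation A: quasi_star_algebra A by (rule A)
interpretation B: quasi_star_algebra B by (rule B)

lemma list_mult_cong_left:
  assumes "list_extend (\<otimes>\<^sub>t) ps = list_extend (\<otimes>\<^sub>t) ps'" and qs: "set qs \<subseteq> core A \<times> core B"
  shows "list_mult A B ps qs = list_mult A B ps' qs"
proof -
  have "balanced_biadditive
      (\<lambda>a b. \<Sum>q\<leftarrow>qs. (case q of (x, y) \<Rightarrow> qmult A a x \<otimes>\<^sub>t qmult B b y))"
    by (rule balanced_biadditive_sum_list)
       (use qs in \<open>auto simp: balanced_biadditive_def tensor_bilinear A.mult_add_left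
          B.mult_add_left A.mult_scaleC_left B.mult_scaleC_left\<close>)
  from list_extend_cong[OF assms(1) this] show ?thesis
    by (simp add: list_extend_def list_mult_def)
qed

lemma list_mult_cong_right:
  assumes "list_extend (\<otimes>\<^sub>t) qs = list_extend (\<otimes>\<^sub>t) qs'" and ps: "set ps \<subseteq> core A \<times> core B"
  shows "list_mult A B ps qs = list_mult A B ps qs'"
proof -
  have "balanced_biadditive
      (\<lambda>x y. \<Sum>p\<leftarrow>ps. (case p of (a, b) \<Rightarrow> qmult A a x \<otimes>\<^sub>t qmult B b y))"
    by (rule balanced_biadditive_sum_list)
       (use ps in \<open>auto simp: balanced_biadditive_def tensor_bilinear A.mult_add_right
          B.mult_add_right A.mult_scaleC_right B.mult_scaleC_right\<close>)
  from list_extend_cong[OF assms(1) this] 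
  have "(\<Sum>(x, y)\<leftarrow>qs. \<Sum>(a, b)\<leftarrow>ps. qmult A a x \<otimes>\<^sub>t qmult B b y) =
        (\<Sum>(x, y)\<leftarrow>qs'. \<Sum>(a, b)\<leftarrow>ps. qmult A a x \<otimes>\<^sub>t qmult B b y)"
    by (simp add: list_extend_def)
  then show ?thesis
    unfolding list_mult_def case_prod_beta sum_list_swap[of _ _ ps] .
qed

text \<open>Two representations of the same element by entries of the *-algebras may only be related
  through entries outside of them; projecting onto the *-algebras removes these.\<close>

lemma list_mult_cong_core:
  assumes eq: "list_extend (\<otimes>\<^sub>t) qs = list_extend (\<otimes>\<^sub>t) qs'"
    and qs: "set qs \<subseteq> core A \<times> core B" and qs': "set qs' \<subseteq> core A \<times> core B"
  shows "list_mult A B ps qs = list_mult A B ps qs'"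
    and "list_mult A B qs ps = list_mult A B qs' ps"
proof -
  obtain P where P: "clinear P" "\<And>x. P x \<in> core A" "\<And>x. x \<in> core A \<Longrightarrow> P x = x"
    using csubspace_projection[OF A.core_subspace] by blast
  obtain R where R: "clinear R" "\<And>x. R x \<in> core B" "\<And>x. x \<in> core B \<Longrightarrow> R x = x"
    using csubspace_projection[OF B.core_subspace] by blast
  interpret P: Vector_Spaces.linear scaleC scaleC P by fact
  interpret R: Vector_Spaces.linear scaleC scaleC R by fact
  note simps = balanced_biadditive_def tensor_bilinear A.mult_add_right
    B.mult_add_right A.mult_scaleC_right B.mult_scaleC_right A.mult_add_left
    B.mult_add_left A.mult_scaleC_left B.mult_scaleC_left P.add P.scale R.add R.scale P(2) R(2)
  let ?f = "\<lambda>x y. \<Sum>p\<leftarrow>ps. (case p of (a, b) \<Rightarrow> qmult A a (P x) \<otimes>\<^sub>t qmult B b (R y))"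
  have f: "list_extend ?f rs = list_mult A B ps rs" if "set rs \<subseteq> core A \<times> core B" for rs
  proof -
    have "list_extend ?f rs = (\<Sum>(x, y)\<leftarrow>rs. \<Sum>(a, b)\<leftarrow>ps. qmult A a x \<otimes>\<^sub>t qmult B b y)"
      unfolding list_extend_def using that
      by (intro arg_cong[of _ _ sum_list] map_cong refl) (auto simp: P(3) R(3))
    then show ?thesis
      unfolding list_mult_def case_prod_beta sum_list_swap[of _ _ ps] .
  qed
  have "balanced_biadditive ?f"
    by (rule balanced_biadditive_sum_list) (auto simp: simps)
  from list_extend_cong[OF eq this] show "list_mult A B ps qs = list_mult A B ps qs'"
    by (simp add: f qs qs')
  let ?g = "\<lambda>x y. \<Sum>p\<leftarrow>ps. (case p of (a, b) \<Rightarrow> qmult A (P x) a \<otimes>\<^sub>t qmult B (R y) b)"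
  have g: "list_extend ?g rs = list_mult A B rs ps" if "set rs \<subseteq> core A \<times> core B" for rs
    unfolding list_extend_def list_mult_def using that
    by (intro arg_cong[of _ _ sum_list] map_cong refl) (auto simp: P(3) R(3))
  have "balanced_biadditive ?g"
    by (rule balanced_biadditive_sum_list) (auto simp: simps)
  from list_extend_cong[OF eq this] show "list_mult A B qs ps = list_mult A B qs' ps"
    by (simp add: g qs qs')
qed

lemma list_mult_unique:
  assumes "list_extend (\<otimes>\<^sub>t) ps = list_extend (\<otimes>\<^sub>t) ps'"
    and "list_extend (\<otimes>\<^sub>t) qs = list_extend (\<otimes>\<^sub>t) qs'"
    and "set ps \<subseteq> core A \<times> core B \<or> set qs \<subseteq> core A \<times> core B"
    and "set ps' \<subseteq> core A \<times> core B \<or> set qs' \<subseteq> core A \<times> core B"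
  shows "list_mult A B ps qs = list_mult A B ps' qs'"
proof -
  let ?K = "core A \<times> core B"
  consider "set ps \<subseteq> ?K" "set ps' \<subseteq> ?K" | "set qs \<subseteq> ?K" "set qs' \<subseteq> ?K"
    | "set ps \<subseteq> ?K" "set qs' \<subseteq> ?K" | "set qs \<subseteq> ?K" "set ps' \<subseteq> ?K"
    using assms(3,4) by blast
  then show ?thesis
  proof cases
    case 1
    from list_mult_cong_core(2)[OF assms(1) 1] list_mult_cong_right[OF assms(2) 1(2)]
    show ?thesis by simp
  next
    case 2
    from list_mult_cong_core(1)[OF assms(2) 2] list_mult_cong_left[OF assms(1) 2(2)]
    show ?thesis by simp
  next
    case 3
    from list_mult_cong_right[OF assms(2) 3(1)] list_mult_cong_left[OF assms(1) 3(2)]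
    show ?thesis by simp
  next
    case 4
    from list_mult_cong_left[OF assms(1) 4(1)] list_mult_cong_right[OF assms(2) 4(2)]
    show ?thesis by simp
  qed
qed

lemma tensor_mult_eq:
  assumes "set ps \<subseteq> core A \<times> core B \<or> set qs \<subseteq> core A \<times> core B"
  shows "tensor_mult A B (\<Sum>(a, b)\<leftarrow>ps. a \<otimes>\<^sub>t b) (\<Sum>(x, y)\<leftarrow>qs. x \<otimes>\<^sub>t y) =
    (\<Sum>(a, b)\<leftarrow>ps. \<Sum>(x, y)\<leftarrow>qs. qmult A a x \<otimes>\<^sub>t qmult B b y)"
proof -
  have *: "list_extend (\<otimes>\<^sub>t) ps = (\<Sum>(a, b)\<leftarrow>ps. a \<otimes>\<^sub>t b)" for ps :: "('a \<times> 'b) list"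
    by (simp add: list_extend_def)
  show ?thesis
    unfolding tensor_mult_def list_mult_def[symmetric]
  proof (rule the_equality)
    show "\<exists>ps' qs'. (\<Sum>(a, b)\<leftarrow>ps. a \<otimes>\<^sub>t b) = (\<Sum>(a, b)\<leftarrow>ps'. a \<otimes>\<^sub>t b) \<and>
        (\<Sum>(x, y)\<leftarrow>qs. x \<otimes>\<^sub>t y) = (\<Sum>(x, y)\<leftarrow>qs'. x \<otimes>\<^sub>t y) \<and>
        (set ps' \<subseteq> core A \<times> core B \<or> set qs' \<subseteq> core A \<times> core B) \<and>
        list_mult A B ps qs = list_mult A B ps' qs'"
      using assms by blast
  next
    fix r
    assume "\<exists>ps' qs'. (\<Sum>(a, b)\<leftarrow>ps. a \<otimes>\<^sub>t b) = (\<Sum>(a, b)\<leftarrow>ps'. a \<otimes>\<^sub>t b) \<and>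
        (\<Sum>(x, y)\<leftarrow>qs. x \<otimes>\<^sub>t y) = (\<Sum>(x, y)\<leftarrow>qs'. x \<otimes>\<^sub>t y) \<and>
        (set ps' \<subseteq> core A \<times> core B \<or> set qs' \<subseteq> core A \<times> core B) \<and>
        r = list_mult A B ps' qs'"
    then obtain ps' qs' where "list_extend (\<otimes>\<^sub>t) ps' = list_extend (\<otimes>\<^sub>t) ps"
        "list_extend (\<otimes>\<^sub>t) qs' = list_extend (\<otimes>\<^sub>t) qs"
        "set ps' \<subseteq> core A \<times> core B \<or> set qs' \<subseteq> core A \<times> core B"
        "r = list_mult A B ps' qs'"
      unfolding * by metis
    then show "r = list_mult A B ps qs"
      using list_mult_unique[OF _ _ _ assms, of ps' qs'] by blast
  qed
qed

lemma tensor_mult_tensor: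
  assumes "a \<in> core A \<and> b \<in> core B \<or> x \<in> core A \<and> y \<in> core B"
  shows "tensor_mult A B (a \<otimes>\<^sub>t b) (x \<otimes>\<^sub>t y) = qmult A a x \<otimes>\<^sub>t qmult B b y"
  using tensor_mult_eq[of "[(a, b)]" "[(x, y)]"] assms by simp

end


section \<open>Uniform cross-norms and the completion\<close>

definition is_norm :: "('v::complex_vector \<Rightarrow> real) \<Rightarrow> bool"
  where "is_norm n \<longleftrightarrow> (\<forall>v. 0 \<le> n v) \<and> (\<forall>v. n v = 0 \<longleftrightarrow> v = 0) \<and>
    (\<forall>v w. n (v + w) \<le> n v + n w) \<and> (\<forall>c v. n (c *\<^sub>C v) = cmod c * n v)"

definition cross_norm ::
    "(('a::complex_normed_vector, 'b::complex_normed_vector) tensor \<Rightarrow> real) \<Rightarrow> bool"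
  where "cross_norm n \<longleftrightarrow> is_norm n \<and> (\<forall>a b. n (a \<otimes>\<^sub>t b) = norm a * norm b)"

text \<open>The bound below says that \<open>tensor_map S T\<close> is \<open>n\<close>-bounded with operator norm at most
  \<open>onorm S * onorm T\<close>; passing to the extension to the completion does not change that norm.\<close>

definition uniform_cross_norm ::
    "(('a::complex_normed_vector, 'b::complex_normed_vector) tensor \<Rightarrow> real) \<Rightarrow> bool"
  where "uniform_cross_norm n \<longleftrightarrow> cross_norm n \<and>
    (\<forall>S T. bounded_clinear S \<longrightarrow> bounded_clinear T \<longrightarrow>
       (\<forall>t. n (tensor_map S T t) \<le> onorm S * onorm T * n t))"

text \<open>\<open>C\<close> is a completion, with canonical embedding \<open>\<iota>\<close>, of the quasi *-algebra \<open>Q\<close> normed by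
  \<open>n\<close>: its *-algebra and unit are those of \<open>Q\<close>, its involution and its two partial products extend
  those of \<open>Q\<close> and are continuous. These conditions determine the operations of \<open>C\<close>.\<close>

definition qsa_completion ::
    "('v::complex_vector \<Rightarrow> real) \<Rightarrow> 'v qsa \<Rightarrow>
     ('v \<Rightarrow> 'c::{complex_normed_vector, complete_space}) \<Rightarrow> 'c qsa \<Rightarrow> bool"
  where "qsa_completion n Q \<iota> C \<longleftrightarrow>
    clinear \<iota> \<and> (\<forall>v. norm (\<iota> v) = n v) \<and> closure (range \<iota>) = UNIV \<and>
    core C = \<iota> ` core Q \<and> qunit C = \<iota> (qunit Q) \<and>
    (\<forall>v. qstar C (\<iota> v) = \<iota> (qstar Q v)) \<and> continuous_on UNIV (qstar C) \<and>
    (\<forall>x\<in>core Q. \<forall>v. qmult C (\<iota> v) (\<iota> x) = \<iota> (qmult Q v x) \<and>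
                     qmult C (\<iota> x) (\<iota> v) = \<iota> (qmult Q x v)) \<and>
    (\<forall>x\<in>core C. continuous_on UNIV (\<lambda>c. qmult C c x) \<and>
                 continuous_on UNIV (\<lambda>c. qmult C x c))"


section \<open>Partial algebras of unbounded operators\<close>

text \<open>An operator with domain \<open>D\<close> is a function that is \<open>undefined\<close> outside of \<open>D\<close>, so that
  equality of operators with the same domain is equality of functions. The functions
  \<open>adj_dom D T\<close> and \<open>adj D T\<close> give the domain and the values of the Hilbert space adjoint of the
  operator \<open>T\<close> with domain \<open>D\<close>.\<close>

definition adj_dom :: "'h::complex_inner set \<Rightarrow> ('h \<Rightarrow> 'h) \<Rightarrow> 'h set"
  where "adj_dom D T = {\<eta>. \<exists>\<zeta>. \<forall>\<xi>\<in>D. cinner (T \<xi>) \<eta> = cinner \<xi> \<zeta>}"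

definition adj :: "'h::complex_inner set \<Rightarrow> ('h \<Rightarrow> 'h) \<Rightarrow> 'h \<Rightarrow> 'h"
  where "adj D T = (\<lambda>\<eta>\<in>adj_dom D T. THE \<zeta>. \<forall>\<xi>\<in>D. cinner (T \<xi>) \<eta> = cinner \<xi> \<zeta>)"

definition closable_on :: "'h::complex_inner set \<Rightarrow> ('h \<Rightarrow> 'h) \<Rightarrow> bool"
  where "closable_on D T \<longleftrightarrow>
    (\<forall>\<xi> \<zeta>. (\<forall>k. \<xi> k \<in> D) \<longrightarrow> \<xi> \<longlonglongrightarrow> 0 \<longrightarrow> (\<lambda>k. T (\<xi> k)) \<longlonglongrightarrow> \<zeta> \<longrightarrow> \<zeta> = 0)"

definition Ldag :: "'h::complex_inner set \<Rightarrow> ('h \<Rightarrow> 'h) set"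
  where "Ldag D = {T \<in> extensional D.
    (\<forall>\<xi>\<in>D. \<forall>\<eta>\<in>D. T (\<xi> + \<eta>) = T \<xi> + T \<eta>) \<and> (\<forall>c. \<forall>\<xi>\<in>D. T (c *\<^sub>C \<xi>) = c *\<^sub>C T \<xi>) \<and>
    closable_on D T \<and> D \<subseteq> adj_dom D T}"

definition dag :: "'h::complex_inner set \<Rightarrow> ('h \<Rightarrow> 'h) \<Rightarrow> 'h \<Rightarrow> 'h"
  where "dag D T = restrict (adj D T) D"

definition weak_prod_defined :: "'h::complex_inner set \<Rightarrow> ('h \<Rightarrow> 'h) \<Rightarrow> ('h \<Rightarrow> 'h) \<Rightarrow> bool"
  where "weak_prod_defined D T S \<longleftrightarrow> S ` D \<subseteq> adj_dom D (dag D T) \<and> dag D T ` D \<subseteq> adj_dom D S"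

definition weak_prod :: "'h::complex_inner set \<Rightarrow> ('h \<Rightarrow> 'h) \<Rightarrow> ('h \<Rightarrow> 'h) \<Rightarrow> 'h \<Rightarrow> 'h"
  where "weak_prod D T S = (\<lambda>\<xi>\<in>D. adj D (dag D T) (S \<xi>))"

definition is_weak_prod ::
    "'h::complex_inner set \<Rightarrow> ('h \<Rightarrow> 'h) \<Rightarrow> ('h \<Rightarrow> 'h) \<Rightarrow> ('h \<Rightarrow> 'h) \<Rightarrow> bool"
  where "is_weak_prod D R T S \<longleftrightarrow> weak_prod_defined D T S \<and> R = weak_prod D T S"

text \<open>Subbase: all open balls of the seminorms \<open>T \<mapsto> |\<langle>T \<xi> | \<eta>\<rangle>|\<close> in \<open>Ldag D\<close>.\<close>

definition weak_topology :: "'h::complex_inner set \<Rightarrow> ('h \<Rightarrow> 'h) topology"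
  where "weak_topology D = topology_generated_by
    {{T \<in> Ldag D. cmod (cinner (T \<xi> - S \<xi>) \<eta>) < \<epsilon>} | S \<xi> \<eta> \<epsilon>.
       S \<in> Ldag D \<and> \<xi> \<in> D \<and> \<eta> \<in> D \<and> 0 < \<epsilon>}"


section \<open>Representations\<close>

definition star_representation ::
    "'a::complex_vector qsa \<Rightarrow> 'h::{complex_inner, complete_space} set \<Rightarrow> ('a \<Rightarrow> 'h \<Rightarrow> 'h) \<Rightarrow> bool"
  where "star_representation Q D \<pi> \<longleftrightarrow>
    csubspace D \<and> closure D = UNIV \<and>
    (\<forall>a. \<pi> a \<in> Ldag D) \<and>
    (\<forall>a b. \<forall>\<xi>\<in>D. \<pi> (a + b) \<xi> = \<pi> a \<xi> + \<pi> b \<xi>) \<and>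
    (\<forall>c a. \<forall>\<xi>\<in>D. \<pi> (c *\<^sub>C a) \<xi> = c *\<^sub>C \<pi> a \<xi>) \<and>
    (\<forall>a. \<pi> (qstar Q a) = dag D (\<pi> a)) \<and>
    (\<forall>a. \<forall>x\<in>core Q. is_weak_prod D (\<pi> (qmult Q a x)) (\<pi> a) (\<pi> x)) \<and>
    \<pi> (qunit Q) = (\<lambda>\<xi>\<in>D. \<xi>)"

definition continuous_star_representation ::
    "'a::complex_normed_vector qsa \<Rightarrow> 'h::{complex_inner, complete_space} set \<Rightarrow>
     ('a \<Rightarrow> 'h \<Rightarrow> 'h) \<Rightarrow> bool"
  where "continuous_star_representation Q D \<pi> \<longleftrightarrow>
    star_representation Q D \<pi> \<and> continuous_map euclidean (weak_topology D) \<pi>"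

definition commuting_factors ::
    "'a::complex_vector qsa \<Rightarrow> 'b::complex_vector qsa \<Rightarrow> (('a, 'b) tensor \<Rightarrow> 'c) \<Rightarrow>
     'h::complex_inner set \<Rightarrow> ('c \<Rightarrow> 'h \<Rightarrow> 'h) \<Rightarrow> ('a \<Rightarrow> 'h \<Rightarrow> 'h) \<Rightarrow> ('b \<Rightarrow> 'h \<Rightarrow> 'h) \<Rightarrow> bool"
  where "commuting_factors A B \<iota> D \<pi> \<pi>\<^sub>1 \<pi>\<^sub>2 \<longleftrightarrow>
    (\<forall>x\<in>core A. \<forall>b. is_weak_prod D (\<pi> (\<iota> (x \<otimes>\<^sub>t b))) (\<pi>\<^sub>1 x) (\<pi>\<^sub>2 b) \<and>
                     is_weak_prod D (\<pi> (\<iota> (x \<otimes>\<^sub>t b))) (\<pi>\<^sub>2 b) (\<pi>\<^sub>1 x)) \<and>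
    (\<forall>a. \<forall>y\<in>core B. is_weak_prod D (\<pi> (\<iota> (a \<otimes>\<^sub>t y))) (\<pi>\<^sub>1 a) (\<pi>\<^sub>2 y) \<and>
                     is_weak_prod D (\<pi> (\<iota> (a \<otimes>\<^sub>t y))) (\<pi>\<^sub>2 y) (\<pi>\<^sub>1 a))"

end

(* The restrictions of \<pi> along the isometric unital embeddings a \<mapsto> a \<otimes> e and b \<mapsto> e \<otimes> b are
   continuous *-representations. In the weak form \<langle>S \<xi> | T\<^sup>\<dagger> \<eta>\<rangle> = \<langle>R \<xi> | \<eta>\<rangle>, the relation
   R = T \<box> S is symmetric under taking adjoints, so that multiplicativity of \<pi> for right factors
   in the core yields multiplicativity for left factors in the core; the factorisations of
   \<pi>(x \<otimes> b) and \<pi>(a \<otimes> y) follow. For uniqueness put y = e or x = e in the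
   factorisations. *)

theory Submission
  imports Defs
begin

lemma cinner_add_right:
  fixes x y z :: "'h::complex_inner"
  shows "cinner x (y + z) = cinner x y + cinner x z"
  by (metis cinner_add_left cinner_commute complex_cnj_add)

lemma cinner_diff_right:
  fixes x y z :: "'h::complex_inner"
  shows "cinner x (y - z) = cinner x y - cinner x z"
  using cinner_add_right[of x "y - z" z] by simp

lemma cinner_diff_left:
  fixes x y z :: "'h::complex_inner"
  shows "cinner (x - y) z = cinner x z - cinner y z"
  using cinner_add_left[of "x - y" y z] by simp

text \<open>Pythagoras: the cross terms of the squared norm vanish. This lets the density argument
  that follows work without continuity of the inner product.\<close>

lemma norm_le_norm_diff_orthogonal:
  fixes w d :: "'h::complex_inner"
  assumes "cinner d w = 0"
  shows "norm w \<le> norm (w - d)"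
proof -
  have "cinner w d = 0"
    using assms cinner_commute[of w d] by simp
  then have "cinner (w - d) (w - d) = cinner w w + cinner d d"
    using assms by (simp add: cinner_diff_left cinner_diff_right)
  then show ?thesis
    by (simp add: norm_eq_sqrt_cinner cinner_ge_zero)
qed

text \<open>If the difference of the two vectors were nonzero, density would give a vector of
  \<open>D\<close> closer to it than 0 is. That vector is orthogonal to the difference, which
  contradicts Pythagoras.\<close>

lemma cinner_dense_eqI:
  fixes D :: "'h::complex_inner set"
  assumes "closure D = UNIV" and eq: "\<And>\<xi>. \<xi> \<in> D \<Longrightarrow> cinner \<xi> \<zeta> = cinner \<xi> \<zeta>'"
  shows "\<zeta> = \<zeta>'"
proof (rule ccontr)
  assume "\<zeta> \<noteq> \<zeta>'"
  then have "norm (\<zeta> - \<zeta>') > 0"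
    by simp
  moreover have "\<zeta> - \<zeta>' \<in> closure D"
    using assms(1) by simp
  ultimately obtain d where d: "d \<in> D" "dist d (\<zeta> - \<zeta>') < norm (\<zeta> - \<zeta>')"
    unfolding closure_approachable by blast
  have "cinner d (\<zeta> - \<zeta>') = 0"
    using eq[OF d(1)] by (simp add: cinner_diff_right)
  from norm_le_norm_diff_orthogonal[OF this] d(2) show False
    by (simp add: dist_norm norm_minus_commute)
qed

text \<open>Density of \<open>D\<close> makes the vector described by \<open>THE\<close> unique, so
  any witness for membership in \<open>adj_dom D T\<close> is the value of the adjoint.\<close>

lemma adj_eqI:
  fixes D :: "'h::complex_inner set"
  assumes "closure D = UNIV" and "\<And>\<xi>. \<xi> \<in> D \<Longrightarrow> cinner (T \<xi>) \<eta> = cinner \<xi> \<zeta>"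
  shows "adj D T \<eta> = \<zeta>"
proof -
  have "\<eta> \<in> adj_dom D T"
    using assms(2) unfolding adj_dom_def by blast
  moreover have "(THE \<zeta>. \<forall>\<xi>\<in>D. cinner (T \<xi>) \<eta> = cinner \<xi> \<zeta>) = \<zeta>"
    using assms(2) by (intro the_equality) (auto intro: cinner_dense_eqI[OF assms(1)])
  ultimately show ?thesis
    by (simp add: adj_def)
qed

lemma cinner_adj:
  fixes D :: "'h::complex_inner set"
  assumes "closure D = UNIV" and "\<eta> \<in> adj_dom D T" and "\<xi> \<in> D"
  shows "cinner (T \<xi>) \<eta> = cinner \<xi> (adj D T \<eta>)"
proof -
  obtain \<zeta> where \<zeta>: "\<And>\<xi>. \<xi> \<in> D \<Longrightarrow> cinner (T \<xi>) \<eta> = cinner \<xi> \<zeta>"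
    using assms(2) unfolding adj_dom_def by blast
  with adj_eqI[OF assms(1) \<zeta>] assms(3) show ?thesis
    by simp
qed

lemma cinner_dag:
  fixes D :: "'h::complex_inner set"
  assumes "closure D = UNIV" and "T \<in> Ldag D" and "\<xi> \<in> D" and "\<eta> \<in> D"
  shows "cinner (T \<xi>) \<eta> = cinner \<xi> (dag D T \<eta>)"
  using assms cinner_adj[of D \<eta> T \<xi>] by (auto simp: Ldag_def dag_def)

text \<open>One identity of sesquilinear forms on \<open>D\<close> replaces both domain conditions
  and the equation for the product. All later statements about weak products are proved in this
  form.\<close>

lemma is_weak_prod_iff:
  fixes D :: "'h::complex_inner set"
  assumes D: "closure D = UNIV" and R: "R \<in> Ldag D"
  shows "is_weak_prod D R T S \<longleftrightarrow>
    (\<forall>\<xi>\<in>D. \<forall>\<eta>\<in>D. cinner (S \<xi>) (dag D T \<eta>) = cinner (R \<xi>) \<eta>)"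
proof
  assume prod: "is_weak_prod D R T S"
  show "\<forall>\<xi>\<in>D. \<forall>\<eta>\<in>D. cinner (S \<xi>) (dag D T \<eta>) = cinner (R \<xi>) \<eta>"
  proof (intro ballI)
    fix \<xi> \<eta> assume "\<xi> \<in> D" "\<eta> \<in> D"
    with prod have "cinner (dag D T \<eta>) (S \<xi>) = cinner \<eta> (R \<xi>)"
      using cinner_adj[OF D, of "S \<xi>" "dag D T" \<eta>]
      by (auto simp: is_weak_prod_def weak_prod_defined_def weak_prod_def)
    then show "cinner (S \<xi>) (dag D T \<eta>) = cinner (R \<xi>) \<eta>"
      by (metis cinner_commute)
  qed
next
  assume weak: "\<forall>\<xi>\<in>D. \<forall>\<eta>\<in>D. cinner (S \<xi>) (dag D T \<eta>) = cinner (R \<xi>) \<eta>"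
  have *: "cinner (dag D T \<eta>) (S \<xi>) = cinner \<eta> (R \<xi>)" if "\<xi> \<in> D" "\<eta> \<in> D" for \<xi> \<eta>
    using weak that by (metis cinner_commute)
  \<comment> \<open>The witness is \<open>R \<xi>\<close>, which is then also the value of the
    adjoint of \<open>dag D T\<close> at \<open>S \<xi>\<close>.\<close>
  have "S ` D \<subseteq> adj_dom D (dag D T)"
    using * unfolding adj_dom_def by blast
  \<comment> \<open>The witness is \<open>dag D R \<eta>\<close>, available because \<open>R\<close>
    lies in \<open>Ldag D\<close>.\<close>
  moreover have "dag D T ` D \<subseteq> adj_dom D S"
    using weak cinner_dag[OF D R] unfolding adj_dom_def by fastforce
  moreover have "R = weak_prod D T S"
  proof (rule extensionalityI)
    show "R \<in> extensional D" "weak_prod D T S \<in> extensional D"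
      using R by (auto simp: Ldag_def weak_prod_def)
    show "R \<xi> = weak_prod D T S \<xi>" if "\<xi> \<in> D" for \<xi>
      using adj_eqI[OF D *] that by (simp add: weak_prod_def)
  qed
  ultimately show "is_weak_prod D R T S"
    by (simp add: is_weak_prod_def weak_prod_defined_def)
qed

text \<open>With the identity as right factor, the weak form of the product is the defining relation
  of \<open>dag D T\<close>, so \<open>T\<close> itself is the product. The two factors determine
  the product.\<close>

lemma is_weak_prod_id_right:
  fixes D :: "'h::complex_inner set"
  assumes D: "closure D = UNIV" and "T \<in> Ldag D" and "R \<in> Ldag D"
    and prod: "is_weak_prod D R T (\<lambda>\<xi>\<in>D. \<xi>)"
  shows "R = T"
proof -
  have "is_weak_prod D T T (\<lambda>\<xi>\<in>D. \<xi>)"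
    using assms(2) by (simp add: is_weak_prod_iff[OF D] cinner_dag[OF D])
  with prod show ?thesis
    by (simp add: is_weak_prod_def)
qed

text \<open>Complex conjugation turns the weak form for the factors T, S into the one for the
  daggers in reverse order. The assumption that daggers lie in \<open>Ldag D\<close> is met by a
  *-representation, where they are the images of adjoint elements.\<close>

lemma is_weak_prod_dag:
  fixes D :: "'h::complex_inner set"
  assumes D: "closure D = UNIV" and R: "R \<in> Ldag D" and S: "S \<in> Ldag D"
    and "dag D R \<in> Ldag D" and S': "dag D S \<in> Ldag D"
    and prod: "is_weak_prod D R T S"
  shows "is_weak_prod D (dag D R) (dag D S) (dag D T)"
  unfolding is_weak_prod_iff[OF D assms(4)]
proof (intro ballI)
  fix \<xi> \<eta> assume \<xi>: "\<xi> \<in> D" and \<eta>: "\<eta> \<in> D"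
  \<comment> \<open>The dagger is involutive: moving \<open>S\<close> across the inner product twice
    gives equal pairings with all vectors of the dense set \<open>D\<close>.\<close>
  have "dag D (dag D S) \<eta> = S \<eta>"
  proof (rule cinner_dense_eqI[OF D])
    fix \<zeta> assume "\<zeta> \<in> D"
    then show "cinner \<zeta> (dag D (dag D S) \<eta>) = cinner \<zeta> (S \<eta>)"
      using cinner_dag[OF D S \<eta>] cinner_dag[OF D S'] \<eta> by (metis cinner_commute)
  qed
  then have "cinner (dag D T \<xi>) (dag D (dag D S) \<eta>) = cnj (cinner (S \<eta>) (dag D T \<xi>))"
    by (metis cinner_commute)
  also have "\<dots> = cnj (cinner (R \<eta>) \<xi>)"
    using prod \<xi> \<eta> by (simp add: is_weak_prod_iff[OF D R])
  also have "\<dots> = cinner (dag D R \<xi>) \<eta>"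
    using cinner_dag[OF D R \<eta> \<xi>] by (metis cinner_commute)
  finally show "cinner (dag D T \<xi>) (dag D (dag D S) \<eta>) = cinner (dag D R \<xi>) \<eta>" .
qed

text \<open>A *-representation is multiplicative by definition only for right factors in the core.
  Writing xa as the adjoint of a* x* and taking daggers covers left factors. The involution laws are
  assumed for the given \<open>x\<close> and \<open>a\<close> alone, so that in the completion they
  need checking only on images of elementary tensors.\<close>

lemma star_representation_mult_core_left:
  assumes rep: "star_representation Q D \<pi>" and "qstar Q x \<in> core Q"
    and "qstar Q (qstar Q x) = x" and "qstar Q (qstar Q a) = a"
    and "qstar Q (qmult Q (qstar Q a) (qstar Q x)) = qmult Q x a"
  shows "is_weak_prod D (\<pi> (qmult Q x a)) (\<pi> x) (\<pi> a)"
proof -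
  have D: "closure D = UNIV" and L: "\<And>c. \<pi> c \<in> Ldag D"
    and star: "\<And>c. \<pi> (qstar Q c) = dag D (\<pi> c)"
    using rep by (auto simp: star_representation_def)
  have "is_weak_prod D (\<pi> (qmult Q (qstar Q a) (qstar Q x))) (\<pi> (qstar Q a)) (\<pi> (qstar Q x))"
    using rep assms(2) unfolding star_representation_def by blast
  from is_weak_prod_dag[OF D L L _ _ this] show ?thesis
    by (simp add: star[symmetric] L assms)
qed

text \<open>Each condition on a continuous *-representation pulls back along a bounded unital map
  respecting core, involution and products. It serves for the two embeddings of the factors into the
  completion.\<close>

lemma continuous_star_representation_comp:
  assumes rep: "continuous_star_representation C D \<pi>" and j: "bounded_clinear j"
    and "\<And>x. x \<in> core Q \<Longrightarrow> j x \<in> core C" and "j (qunit Q) = qunit C"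
    and "\<And>a. j (qstar Q a) = qstar C (j a)"
    and "\<And>a x. x \<in> core Q \<Longrightarrow> j (qmult Q a x) = qmult C (j a) (j x)"
  shows "continuous_star_representation Q D (\<lambda>a. \<pi> (j a))"
proof -
  interpret j: Vector_Spaces.linear scaleC scaleC j
    using j by (simp add: bounded_clinear_def)
  have "star_representation Q D (\<lambda>a. \<pi> (j a))"
    using rep assms(3-)
    unfolding continuous_star_representation_def star_representation_def
    by (simp add: j.add j.scale)
  moreover have "continuous_map euclidean euclidean j"
    using j by (simp add: bounded_clinear_def linear_continuous_on)
  with rep have "continuous_map euclidean (weak_topology D) (\<pi> \<circ> j)"
    unfolding continuous_star_representation_def by (blast intro: continuous_map_compose)
  ultimately show ?thesis
    by (simp add: continuous_star_representation_def comp_def)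
qed

lemma bounded_clinearI:
  assumes "clinear f" and "\<And>x. norm (f x) \<le> norm x * K"
  shows "bounded_clinear f"
proof -
  interpret f: Vector_Spaces.linear scaleC scaleC f by fact
  have "bounded_linear f"
    by (rule bounded_linear_intro[of _ K]) (simp_all add: f.add f.scale scaleR_scaleC assms(2))
  with assms(1) show ?thesis
    by (simp add: bounded_clinear_def)
qed

text \<open>For the unit e one has e* = e* e** = (e* e)* = e** = e.\<close>

lemma (in quasi_star_algebra) star_unit: "qstar Q (qunit Q) = qunit Q"
proof -
  have "qstar Q (qunit Q) = qmult Q (qstar Q (qunit Q)) (qstar Q (qstar Q (qunit Q)))"
    by (simp add: star_star mult_unit_right)
  also have "\<dots> = qstar Q (qmult Q (qstar Q (qunit Q)) (qunit Q))"
    by (simp add: star_mult unit_core)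
  finally show ?thesis
    by (simp add: star_star mult_unit_right)
qed

lemma tensor_in_tensor_core:
  "x \<in> core A \<Longrightarrow> y \<in> core B \<Longrightarrow> x \<otimes>\<^sub>t y \<in> tensor_core A B"
  unfolding tensor_core_def by (rule complex_vector.span_base) blast

theorem proposition6p2:
  fixes A :: "'a::{complex_normed_vector, complete_space} qsa"
    and B :: "'b::{complex_normed_vector, complete_space} qsa"
    and n :: "('a, 'b) tensor \<Rightarrow> real"
    and \<iota> :: "('a, 'b) tensor \<Rightarrow> 'c::{complex_normed_vector, complete_space}"
    and C :: "'c qsa"
    and D :: "'h::{complex_inner, complete_space} set"
    and \<pi> :: "'c \<Rightarrow> 'h \<Rightarrow> 'h"
  assumes "banach_quasi_star_algebra A"
    and "banach_quasi_star_algebra B"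
    and "uniform_cross_norm n"
    and "\<forall>t. n (tensor_star A B t) = n t"
    and "qsa_completion n (tensor_qsa A B) \<iota> C"
    and "continuous_star_representation C D \<pi>"
  shows "(\<exists>!p. case p of (\<pi>\<^sub>1, \<pi>\<^sub>2) \<Rightarrow>
             continuous_star_representation A D \<pi>\<^sub>1 \<and>
             continuous_star_representation B D \<pi>\<^sub>2 \<and>
             commuting_factors A B \<iota> D \<pi> \<pi>\<^sub>1 \<pi>\<^sub>2) \<and>
         (\<forall>\<pi>\<^sub>1 \<pi>\<^sub>2.
             continuous_star_representation A D \<pi>\<^sub>1 \<and>
             continuous_star_representation B D \<pi>\<^sub>2 \<and>
             commuting_factors A B \<iota> D \<pi> \<pi>\<^sub>1 \<pi>\<^sub>2 \<longrightarrow>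
             (\<forall>a. \<pi>\<^sub>1 a = \<pi> (\<iota> (a \<otimes>\<^sub>t qunit B))) \<and>
             (\<forall>b. \<pi>\<^sub>2 b = \<pi> (\<iota> (qunit A \<otimes>\<^sub>t b))))"
proof -
  interpret A: banach_quasi_star_algebra A by fact
  interpret B: banach_quasi_star_algebra B by fact
  note qsa = A.quasi_star_algebra_axioms B.quasi_star_algebra_axioms
  note C = assms(5)[unfolded qsa_completion_def]
  interpret \<iota>: Vector_Spaces.linear scaleC scaleC \<iota>
    using C by simp
  let ?e = "qunit A" and ?f = "qunit B"
  note simps = A.unit_core B.unit_core A.core_star B.core_star A.star_unit B.star_unit
    A.star_star B.star_star A.mult_unit_left A.mult_unit_right B.mult_unit_left B.mult_unit_right
  have rep: "star_representation C D \<pi>"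
    using assms(6) by (simp add: continuous_star_representation_def)
  have D: "closure D = UNIV" and L: "\<And>c. \<pi> c \<in> Ldag D"
    using rep by (auto simp: star_representation_def)
  have norm_\<iota>: "norm (\<iota> (a \<otimes>\<^sub>t b)) = norm a * norm b" for a b
    using C assms(3) by (simp add: uniform_cross_norm_def cross_norm_def)
  \<comment> \<open>The next facts reduce the operations of \<open>C\<close> on images of elementary
    tensors to those of \<open>A\<close> and \<open>B\<close>.\<close>
  have unit: "qunit C = \<iota> (?e \<otimes>\<^sub>t ?f)"
    using C by (simp add: tensor_qsa_def)
  have core: "\<iota> (x \<otimes>\<^sub>t y) \<in> core C" if "x \<in> core A" "y \<in> core B" for x y
    using C that by (simp add: tensor_qsa_def tensor_in_tensor_core)
  have star: "qstar C (\<iota> (a \<otimes>\<^sub>t b)) = \<iota> (qstar A a \<otimes>\<^sub>t qstar B b)" for a b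
    using C by (simp add: tensor_qsa_def tensor_star_tensor[OF qsa])
  have mult: "qmult C (\<iota> (a \<otimes>\<^sub>t b)) (\<iota> (x \<otimes>\<^sub>t y)) = \<iota> (qmult A a x \<otimes>\<^sub>t qmult B b y)"
    if "a \<in> core A \<and> b \<in> core B \<or> x \<in> core A \<and> y \<in> core B" for a b x y
    using C that tensor_mult_tensor[OF qsa that] tensor_in_tensor_core[of _ A _ B]
    by (auto simp: tensor_qsa_def)

  let ?\<pi>\<^sub>1 = "\<lambda>a. \<pi> (\<iota> (a \<otimes>\<^sub>t ?f))" and ?\<pi>\<^sub>2 = "\<lambda>b. \<pi> (\<iota> (?e \<otimes>\<^sub>t b))"
  have rep1: "continuous_star_representation A D ?\<pi>\<^sub>1"
  proof (rule continuous_star_representation_comp[OF assms(6), where j = "\<lambda>a. \<iota> (a \<otimes>\<^sub>t ?f)"])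
    show "bounded_clinear (\<lambda>a. \<iota> (a \<otimes>\<^sub>t ?f))"
    proof (rule bounded_clinearI)
      show "clinear (\<lambda>a. \<iota> (a \<otimes>\<^sub>t ?f))"
        by unfold_locales (simp_all add: tensor_bilinear \<iota>.add \<iota>.scale)
      show "norm (\<iota> (a \<otimes>\<^sub>t ?f)) \<le> norm a * norm ?f" for a
        by (simp add: norm_\<iota>)
    qed
  qed (simp_all add: core unit star mult simps)
  have rep2: "continuous_star_representation B D ?\<pi>\<^sub>2"
  proof (rule continuous_star_representation_comp[OF assms(6), where j = "\<lambda>b. \<iota> (?e \<otimes>\<^sub>t b)"])
    show "bounded_clinear (\<lambda>b. \<iota> (?e \<otimes>\<^sub>t b))"
    proof (rule bounded_clinearI)
      show "clinear (\<lambda>b. \<iota> (?e \<otimes>\<^sub>t b))"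
        by unfold_locales (simp_all add: tensor_bilinear \<iota>.add \<iota>.scale)
      show "norm (\<iota> (?e \<otimes>\<^sub>t b)) \<le> norm b * norm ?e" for b
        by (simp add: norm_\<iota>)
    qed
  qed (simp_all add: core unit star mult simps)

  have right: "is_weak_prod D (\<pi> (qmult C a x)) (\<pi> a) (\<pi> x)" if "x \<in> core C" for a x
    using rep that unfolding star_representation_def by blast
  \<comment> \<open>On elementary tensors the conditions on the involution split into the involution
    laws of the two factors.\<close>
  have left: "is_weak_prod D (\<pi> (qmult C (\<iota> (x \<otimes>\<^sub>t y)) (\<iota> (a \<otimes>\<^sub>t b))))
      (\<pi> (\<iota> (x \<otimes>\<^sub>t y))) (\<pi> (\<iota> (a \<otimes>\<^sub>t b)))" if "x \<in> core A" "y \<in> core B" for x y a b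
    by (rule star_representation_mult_core_left[OF rep])
      (use that in \<open>simp_all add: core star mult simps A.star_mult B.star_mult\<close>)
  have comm: "commuting_factors A B \<iota> D \<pi> ?\<pi>\<^sub>1 ?\<pi>\<^sub>2"
    unfolding commuting_factors_def
  proof (intro conjI allI ballI)
    fix x b assume x: "x \<in> core A"
    \<comment> \<open>The tensor of x and b is a product, in either order, of x tensor unit and unit
      tensor b. Only the former is known to be in the core, so one order needs \<open>left\<close>
      and the other \<open>right\<close>.\<close>
    from left[OF x B.unit_core, of ?e b] x
    show "is_weak_prod D (\<pi> (\<iota> (x \<otimes>\<^sub>t b))) (?\<pi>\<^sub>1 x) (?\<pi>\<^sub>2 b)"
      by (simp add: mult simps)
    from right[OF core[OF x B.unit_core], of "\<iota> (?e \<otimes>\<^sub>t b)"] x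
    show "is_weak_prod D (\<pi> (\<iota> (x \<otimes>\<^sub>t b))) (?\<pi>\<^sub>2 b) (?\<pi>\<^sub>1 x)"
      by (simp add: mult simps)
  next
    fix a y assume y: "y \<in> core B"
    \<comment> \<open>Now the core factor is unit tensor y, so \<open>left\<close> and
      \<open>right\<close> exchange roles.\<close>
    from right[OF core[OF A.unit_core y], of "\<iota> (a \<otimes>\<^sub>t ?f)"] y
    show "is_weak_prod D (\<pi> (\<iota> (a \<otimes>\<^sub>t y))) (?\<pi>\<^sub>1 a) (?\<pi>\<^sub>2 y)"
      by (simp add: mult simps)
    from left[OF A.unit_core y, of a ?f] y
    show "is_weak_prod D (\<pi> (\<iota> (a \<otimes>\<^sub>t y))) (?\<pi>\<^sub>2 y) (?\<pi>\<^sub>1 a)"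
      by (simp add: mult simps)
  qed

  have uniq: "(\<forall>a. \<pi>\<^sub>1 a = ?\<pi>\<^sub>1 a) \<and> (\<forall>b. \<pi>\<^sub>2 b = ?\<pi>\<^sub>2 b)"
    if "continuous_star_representation A D \<pi>\<^sub>1" "continuous_star_representation B D \<pi>\<^sub>2"
      "commuting_factors A B \<iota> D \<pi> \<pi>\<^sub>1 \<pi>\<^sub>2" for \<pi>\<^sub>1 \<pi>\<^sub>2
  proof -
    have 1: "\<pi>\<^sub>1 a \<in> Ldag D" "\<pi>\<^sub>1 ?e = (\<lambda>\<xi>\<in>D. \<xi>)" for a
      using that(1) by (simp_all add: continuous_star_representation_def star_representation_def)
    have 2: "\<pi>\<^sub>2 b \<in> Ldag D" "\<pi>\<^sub>2 ?f = (\<lambda>\<xi>\<in>D. \<xi>)" for b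
      using that(2) by (simp_all add: continuous_star_representation_def star_representation_def)
    \<comment> \<open>Of the two orders, each factorisation is taken with the identity operator on
      the right, as \<open>is_weak_prod_id_right\<close> requires.\<close>
    have "is_weak_prod D (?\<pi>\<^sub>1 a) (\<pi>\<^sub>1 a) (\<lambda>\<xi>\<in>D. \<xi>)"
      "is_weak_prod D (?\<pi>\<^sub>2 b) (\<pi>\<^sub>2 b) (\<lambda>\<xi>\<in>D. \<xi>)" for a b
      using that(3) A.unit_core B.unit_core 1(2) 2(2)
      unfolding commuting_factors_def by metis+
    then show ?thesis
      using is_weak_prod_id_right[OF D _ L] 1(1) 2(1) by metis
  qed
  show ?thesis
  proof (intro conjI)
    show "\<exists>!p. case p of (\<pi>\<^sub>1, \<pi>\<^sub>2) \<Rightarrow>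
        continuous_star_representation A D \<pi>\<^sub>1 \<and> continuous_star_representation B D \<pi>\<^sub>2 \<and>
        commuting_factors A B \<iota> D \<pi> \<pi>\<^sub>1 \<pi>\<^sub>2"
    proof (rule ex1I[of _ "(?\<pi>\<^sub>1, ?\<pi>\<^sub>2)"])
      show "p = (?\<pi>\<^sub>1, ?\<pi>\<^sub>2)" if "case p of (\<pi>\<^sub>1, \<pi>\<^sub>2) \<Rightarrow>
        continuous_star_representation A D \<pi>\<^sub>1 \<and> continuous_star_representation B D \<pi>\<^sub>2 \<and>
        commuting_factors A B \<iota> D \<pi> \<pi>\<^sub>1 \<pi>\<^sub>2" for p
        using that uniq by (cases p) (auto simp: fun_eq_iff)
    qed (simp add: rep1 rep2 comm)
  qed (use uniq in blast)
qed

end
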